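(* Let $d=2$. There exist constants $C>0$ and $T>0$, independent of $N,h,x$ and $t$, such that $$|K_{N,h}(x,t)|\le C\,|t|^{-\frac12}$$ for all $t$ with $|t|\ge T$, all dyadic numbers $N\in 2^{\mathbb Z}$ with $N\le 1$, all $h>0$ and all $x\in h\mathbb Z^2$, where $$K_{N,h}(x,t)=\int_{\mathbb T_h^2}\exp\left\{ i x\cdot\xi+ i\,\frac{16\,t}{h^4}\left(\sum_{j=1}^{2}\sin^2\left(\frac{h\xi_j}{2}\right)\right)^2\right\}\eta\left(\frac{h\xi}{N}\right)d\xi .$$
   Context: Notation: $2^{\mathbb Z}=\{2^j: j\in\mathbb Z\}$; $h\mathbb Z^2=\{hn: n\in\mathbb Z^2\}$; $\mathbb T_h^2=\frac1h[-\pi,\pi]^2$. The cutoff $\eta$ is fixed as follows. Fix a smooth axisymmetric function $\varphi:\mathbb R^2\to[0,1]$ (even in each coordinate) with $\varphi=1$ on $[-1,1]^2$ and $\varphi=0$ on $\mathbb R^2\setminus[-2,2]^2$, and set $$\eta(\xi)=\varphi\left(\frac{\xi}{2\pi}\right)-\varphi\left(\frac{\xi}{\pi}\right).$$ The constants may depend on the fixed choice of $\varphi$. *)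

theory Defs
  imports "HOL-Analysis.Analysis"
begin

(* f is C^k iff it is differentiable and each directional derivative (in a fixed direction v) is C^(k-1). *)
primrec Ck :: "nat \<Rightarrow> ('a::euclidean_space \<Rightarrow> real) \<Rightarrow> bool" where
  "Ck 0 f \<longleftrightarrow> continuous_on UNIV f"
| "Ck (Suc k) f \<longleftrightarrow> f differentiable_on UNIV \<and> (\<forall>v. Ck k (\<lambda>x. frechet_derivative f (at x) v))"

definition smooth :: "('a::euclidean_space \<Rightarrow> real) \<Rightarrow> bool" where
  "smooth f \<longleftrightarrow> (\<forall>k. Ck k f)"

definition square :: "real \<Rightarrow> (real^2) set" where
  "square r = cbox (\<chi> j. - r) (\<chi> j. r)"

definition torus :: "real \<Rightarrow> (real^2) set" where
  "torus h = (\<lambda>\<xi>. (1 / h) *\<^sub>R \<xi>) ` square pi"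

definition lattice :: "real \<Rightarrow> (real^2) set" where
  "lattice h = range (\<lambda>n :: int^2. h *\<^sub>R (\<chi> j. of_int (n $ j)))"

definition dyadic :: "real set" where
  "dyadic = range (\<lambda>j::int. 2 powi j)"

(* The third clause is invariance under each coordinate reflection ("axisymmetric"). *)
definition is_cutoff :: "(real^2 \<Rightarrow> real) \<Rightarrow> bool" where
  "is_cutoff \<phi> \<longleftrightarrow>
     smooth \<phi> \<and>
     range \<phi> \<subseteq> {0..1} \<and>
     (\<forall>j \<xi>. \<phi> (\<chi> i. if i = j then - (\<xi> $ i) else \<xi> $ i) = \<phi> \<xi>) \<and>
     (\<forall>\<xi> \<in> square 1. \<phi> \<xi> = 1) \<and>
     (\<forall>\<xi>. \<xi> \<notin> square 2 \<longrightarrow> \<phi> \<xi> = 0)"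

definition \<eta> :: "(real^2 \<Rightarrow> real) \<Rightarrow> real^2 \<Rightarrow> real" where
  "\<eta> \<phi> \<xi> = \<phi> ((1 / (2 * pi)) *\<^sub>R \<xi>) - \<phi> ((1 / pi) *\<^sub>R \<xi>)"

definition K :: "(real^2 \<Rightarrow> real) \<Rightarrow> real \<Rightarrow> real \<Rightarrow> real^2 \<Rightarrow> real \<Rightarrow> complex" where
  "K \<phi> N h x t =
     (LINT \<xi>:torus h|lborel.
        exp (\<i> * of_real (x \<bullet> \<xi>)
           + \<i> * of_real (16 * t / h ^ 4 * (\<Sum>j\<in>UNIV. (sin (h * \<xi> $ j / 2))\<^sup>2)\<^sup>2))
        * of_real (\<eta> \<phi> ((h / N) *\<^sub>R \<xi>)))"

end

(*
  Substituting zeta = h xi turns the kernel into h^-2 times an oscillatory integral over [-pi,pi]^2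
  with phase (linear) + tau omega^2, where tau = 4t/h^4 and omega = 2 - cos zeta_1 - cos zeta_2; it
  suffices to bound this by C |tau|^(-1/2), uniformly in N and in the linear part.  Only one
  non-degenerate direction is needed: at every point of [-pi,pi]^2 except the origin some second
  directional derivative of omega^2 along (s,1), |s| <= 1, is non-zero, so the one-dimensional
  van der Corput lemma applies on slices parallel to (s,1).  For N >= 1/16 a compactness argument
  makes this uniform, the amplitude being zero near the origin.  For N <= 1/16 the vertical direction
  alone works: the second derivative is at least of order N^2 on the support, which lies in a square
  of side of order N, and the factor N gained from the area cancels the N lost from (tau N^2)^(-1/2).
*)
theory Submission
  imports Defs
begin

section \<open>Van der Corput estimates\<close>

lemma has_vector_derivative_cis_comp:
  assumes "(f has_real_derivative D) (at x within S)"
  shows "((\<lambda>x. cis (f x)) has_vector_derivative (\<i> * of_real D * cis (f x))) (at x within S)"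
proof -
  have "((\<lambda>x. Complex (cos (f x)) (sin (f x))) has_vector_derivative
      Complex (- sin (f x) * D) (cos (f x) * D)) (at x within S)"
    unfolding has_vector_derivative_complex_iff
    using assms by (auto intro!: derivative_eq_intros)
  moreover have "Complex (- sin (f x) * D) (cos (f x) * D) = \<i> * of_real D * cis (f x)"
    by (simp add: complex_eq_iff)
  ultimately show ?thesis by (simp add: cis.code)
qed

text \<open>Integration by parts against \<open>cis \<psi>\<close>, divided by \<psi>' =
  \<open>\<psi>1\<close>. Since \<open>\<psi>1\<close> is nondecreasing, the variation of
  \<open>1 / \<psi>1\<close> is at most \<open>1 / \<delta>\<close>, so the size of
  \<open>\<psi>2\<close> does not enter the bound. Two boundary terms and this variation give
  \<open>3 * M\<close>.\<close>

lemma van_der_corput_first: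
  fixes \<psi> \<psi>1 \<psi>2 A A1 :: "real \<Rightarrow> real"
  assumes pq: "p \<le> q" and \<delta>: "\<delta> > 0"
    and d\<psi>: "\<And>v. v \<in> {p..q} \<Longrightarrow> (\<psi> has_real_derivative \<psi>1 v) (at v)"
    and d\<psi>1: "\<And>v. v \<in> {p..q} \<Longrightarrow> (\<psi>1 has_real_derivative \<psi>2 v) (at v)"
    and dA: "\<And>v. v \<in> {p..q} \<Longrightarrow> (A has_real_derivative A1 v) (at v)"
    and c2: "continuous_on {p..q} \<psi>2" and cA1: "continuous_on {p..q} A1"
    and lower: "\<And>v. v \<in> {p..q} \<Longrightarrow> \<psi>1 v \<ge> \<delta>"
    and nonneg: "\<And>v. v \<in> {p..q} \<Longrightarrow> \<psi>2 v \<ge> 0"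
    and M: "\<And>v. v \<in> {p..q} \<Longrightarrow> \<bar>A v\<bar> \<le> M"
    and M': "\<And>v. v \<in> {p..q} \<Longrightarrow> \<bar>A1 v\<bar> \<le> M'"
  shows "norm (integral {p..q} (\<lambda>v. A v *\<^sub>R cis (\<psi> v))) \<le> (3 * M + M' * (q - p)) / \<delta>"
proof -
  have pos: "\<psi>1 v > 0" if "v \<in> {p..q}" for v using lower[OF that] \<delta> by linarith
  have M0: "M \<ge> 0" using M[of p] pq by auto
  \<comment> \<open>\<open>E\<close> is the derivative of \<open>A / \<psi>1\<close>. Hence the
    derivative of \<open>B\<close> is the integrand times the imaginary unit, plus the error term
    \<open>E v *\<^sub>R cis (\<psi> v)\<close>.\<close>
  define E where "E v = A1 v / \<psi>1 v - A v * \<psi>2 v / (\<psi>1 v)\<^sup>2" for v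
  define B where "B v = (A v / \<psi>1 v) *\<^sub>R cis (\<psi> v)" for v
  have cont: "continuous_on {p..q} \<psi>" "continuous_on {p..q} \<psi>1" "continuous_on {p..q} A"
    by (intro continuous_at_imp_continuous_on ballI; blast intro: DERIV_isCont d\<psi> d\<psi>1 dA)+
  have ccis: "continuous_on {p..q} (\<lambda>v. cis (\<psi> v))"
    using cont by (intro continuous_intros)
  have cE: "continuous_on {p..q} E"
    unfolding E_def using cont c2 cA1 pos by (intro continuous_intros) (auto simp: less_le)
  have dB: "(B has_vector_derivative (\<i> * (A v *\<^sub>R cis (\<psi> v)) + E v *\<^sub>R cis (\<psi> v)))
      (at v within {p..q})" if v: "v \<in> {p..q}" for v
  proof -
    have 1: "((\<lambda>v. A v / \<psi>1 v) has_real_derivative E v) (at v within {p..q})"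
      using pos[OF v] unfolding E_def
      by (auto intro!: derivative_eq_intros has_field_derivative_at_within[OF dA[OF v]]
          has_field_derivative_at_within[OF d\<psi>1[OF v]] simp: field_simps power2_eq_square)
    have "(B has_vector_derivative ((A v / \<psi>1 v) *\<^sub>R (\<i> * of_real (\<psi>1 v) * cis (\<psi> v))
        + E v *\<^sub>R cis (\<psi> v))) (at v within {p..q})"
      unfolding B_def
      by (rule has_vector_derivative_scaleR[OF 1 has_vector_derivative_cis_comp])
        (rule has_field_derivative_at_within[OF d\<psi>[OF v]])
    moreover have "(A v / \<psi>1 v) *\<^sub>R (\<i> * of_real (\<psi>1 v) * cis (\<psi> v)) = \<i> * (A v *\<^sub>R cis (\<psi> v))"
      using pos[OF v] by (simp add: scaleR_conv_of_real field_simps)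
    ultimately show ?thesis by simp
  qed
  have iA: "(\<lambda>v. A v *\<^sub>R cis (\<psi> v)) integrable_on {p..q}"
    and iE: "(\<lambda>v. E v *\<^sub>R cis (\<psi> v)) integrable_on {p..q}"
    using cont ccis cE by (auto intro!: integrable_continuous_interval continuous_intros)
  have "((\<lambda>v. \<i> * (A v *\<^sub>R cis (\<psi> v)) + E v *\<^sub>R cis (\<psi> v)) has_integral (B q - B p)) {p..q}"
    by (rule fundamental_theorem_of_calculus[OF pq dB])
  moreover have "((\<lambda>v. \<i> * (A v *\<^sub>R cis (\<psi> v)) + E v *\<^sub>R cis (\<psi> v)) has_integral
      (\<i> * integral {p..q} (\<lambda>v. A v *\<^sub>R cis (\<psi> v)) + integral {p..q} (\<lambda>v. E v *\<^sub>R cis (\<psi> v)))) {p..q}"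
    using iA iE by (intro has_integral_add has_integral_mult_right integrable_integral)
  ultimately have eq: "\<i> * integral {p..q} (\<lambda>v. A v *\<^sub>R cis (\<psi> v))
      = B q - B p - integral {p..q} (\<lambda>v. E v *\<^sub>R cis (\<psi> v))"
    by (auto dest: has_integral_unique simp: algebra_simps)
  have nB: "norm (B v) \<le> M / \<delta>" if v: "v \<in> {p..q}" for v
    using M[OF v] lower[OF v] pos[OF v] \<delta> unfolding B_def
    by (auto intro: frac_le)
  \<comment> \<open>A majorant of the absolute value of \<open>E\<close> that integrates exactly:
    its second summand is the derivative of \<open>- M / \<psi>1\<close>.\<close>
  define w where "w v = M' / \<delta> + M * \<psi>2 v / (\<psi>1 v)\<^sup>2" for v
  have "(w has_integral (M' / \<delta> * q - M / \<psi>1 q) - (M' / \<delta> * p - M / \<psi>1 p)) {p..q}"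
  proof (rule fundamental_theorem_of_calculus[OF pq])
    fix v assume v: "v \<in> {p..q}"
    have "((\<lambda>v. M' / \<delta> * v - M / \<psi>1 v) has_real_derivative w v) (at v within {p..q})"
      using pos[OF v] \<delta> unfolding w_def
      by (auto intro!: derivative_eq_intros has_field_derivative_at_within[OF d\<psi>1[OF v]]
          simp: field_simps power2_eq_square)
    then show "((\<lambda>v. M' / \<delta> * v - M / \<psi>1 v) has_vector_derivative w v) (at v within {p..q})"
      by (simp add: has_real_derivative_iff_has_vector_derivative)
  qed
  then have w: "w integrable_on {p..q}"
      "integral {p..q} w = M' / \<delta> * (q - p) + M / \<psi>1 p - M / \<psi>1 q"
    by (auto simp: has_integral_iff algebra_simps diff_divide_distrib)
  have "norm (integral {p..q} (\<lambda>v. E v *\<^sub>R cis (\<psi> v))) \<le> integral {p..q} w"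
  proof (rule integral_norm_bound_integral[OF iE w(1)])
    fix v assume v: "v \<in> {p..q}"
    have "\<bar>A1 v / \<psi>1 v\<bar> \<le> M' / \<delta>"
      using M'[OF v] lower[OF v] pos[OF v] \<delta> by (auto intro: frac_le)
    moreover have "\<bar>A v * \<psi>2 v / (\<psi>1 v)\<^sup>2\<bar> \<le> M * \<psi>2 v / (\<psi>1 v)\<^sup>2"
      using M[OF v] nonneg[OF v] by (auto simp: abs_mult intro!: divide_right_mono mult_right_mono)
    ultimately have "\<bar>E v\<bar> \<le> w v" unfolding E_def w_def by linarith
    then show "norm (E v *\<^sub>R cis (\<psi> v)) \<le> w v" by simp
  qed
  moreover have "M / \<psi>1 p \<le> M / \<delta>" "M / \<psi>1 q \<ge> 0"
    using lower[of p] pos[of p] pos[of q] pq \<delta> M0 by (auto intro: frac_le)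
  ultimately have nE: "norm (integral {p..q} (\<lambda>v. E v *\<^sub>R cis (\<psi> v))) \<le> M' / \<delta> * (q - p) + M / \<delta>"
    using w by linarith
  have "norm (integral {p..q} (\<lambda>v. A v *\<^sub>R cis (\<psi> v)))
      = norm (B q - B p - integral {p..q} (\<lambda>v. E v *\<^sub>R cis (\<psi> v)))"
    unfolding eq[symmetric] by (simp add: norm_mult)
  also have "\<dots> \<le> norm (B q) + norm (B p) + norm (integral {p..q} (\<lambda>v. E v *\<^sub>R cis (\<psi> v)))"
    by (smt (verit) norm_triangle_ineq4)
  also have "\<dots> \<le> M / \<delta> + M / \<delta> + (M' / \<delta> * (q - p) + M / \<delta>)"
    using nB[of p] nB[of q] nE pq by (intro add_mono) auto
  also have "\<dots> = (3 * M + M' * (q - p)) / \<delta>" using \<delta> by (simp add: field_simps)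
  finally show ?thesis .
qed

lemma van_der_corput_second:
  fixes \<psi> \<psi>1 \<psi>2 A A1 :: "real \<Rightarrow> real"
  assumes pq: "p \<le> q" and \<mu>: "\<mu> > 0"
    and d\<psi>: "\<And>v. v \<in> {p..q} \<Longrightarrow> (\<psi> has_real_derivative \<psi>1 v) (at v)"
    and d\<psi>1: "\<And>v. v \<in> {p..q} \<Longrightarrow> (\<psi>1 has_real_derivative \<psi>2 v) (at v)"
    and dA: "\<And>v. v \<in> {p..q} \<Longrightarrow> (A has_real_derivative A1 v) (at v)"
    and c2: "continuous_on {p..q} \<psi>2" and cA1: "continuous_on {p..q} A1"
    and lower: "\<And>v. v \<in> {p..q} \<Longrightarrow> \<psi>2 v \<ge> \<mu>"
    and M: "\<And>v. v \<in> {p..q} \<Longrightarrow> \<bar>A v\<bar> \<le> M"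
    and M': "\<And>v. v \<in> {p..q} \<Longrightarrow> \<bar>A1 v\<bar> \<le> M'"
  shows "norm (integral {p..q} (\<lambda>v. A v *\<^sub>R cis (\<psi> v))) \<le> (8 * M + 2 * M' * (q - p)) / sqrt \<mu>"
proof -
  let ?f = "\<lambda>v. A v *\<^sub>R cis (\<psi> v)"
  have M0: "M \<ge> 0" and M'0: "M' \<ge> 0" using M[of p] M'[of p] pq by auto
  have incr: "\<psi>1 w - \<psi>1 v \<ge> \<mu> * (w - v)" if "v \<in> {p..q}" "w \<in> {p..q}" "v \<le> w" for v w
  proof -
    have "\<psi>1 v - \<mu> * v \<le> \<psi>1 w - \<mu> * w"
    proof (rule DERIV_nonneg_imp_nondecreasing[OF \<open>v \<le> w\<close>])
      fix x assume "v \<le> x" "x \<le> w"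
      then have x: "x \<in> {p..q}" using that by auto
      show "\<exists>y. ((\<lambda>v. \<psi>1 v - \<mu> * v) has_real_derivative y) (at x) \<and> 0 \<le> y"
        using lower[OF x]
        by (intro exI[of _ "\<psi>2 x - \<mu>"]) (auto intro!: derivative_eq_intros d\<psi>1[OF x])
    qed
    then show ?thesis by (simp add: algebra_simps)
  qed
  have cont: "continuous_on {p..q} \<psi>" "continuous_on {p..q} \<psi>1" "continuous_on {p..q} A"
    by (intro continuous_at_imp_continuous_on ballI; blast intro: DERIV_isCont d\<psi> d\<psi>1 dA)+
  \<comment> \<open>\<open>\<psi>1\<close> grows at rate at least \<open>\<mu>\<close> away from its zero \<open>z\<close> (or the endpoint nearest to a zero), so
    \<open>\<bar>\<psi>1\<bar> \<ge> sqrt \<mu>\<close> outside a window of radius \<open>1 / sqrt \<mu>\<close>, on which the trivial bound is used.\<close>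
  have "\<exists>z\<in>{p..q}. (z = q \<or> \<psi>1 z \<ge> 0) \<and> (z = p \<or> \<psi>1 z \<le> 0)"
  proof -
    consider "\<psi>1 p \<ge> 0" | "\<psi>1 q \<le> 0" | "\<psi>1 p \<le> 0" "0 \<le> \<psi>1 q" by linarith
    then show ?thesis
    proof cases
      case 3
      then obtain z where "z \<in> {p..q}" "\<psi>1 z = 0" using IVT'[OF _ _ pq cont(2), of 0] by auto
      then show ?thesis by (intro bexI[of _ z]) auto
    qed (use pq in auto)
  qed
  then obtain z where z: "z \<in> {p..q}" "z = q \<or> \<psi>1 z \<ge> 0" "z = p \<or> \<psi>1 z \<le> 0" by blast
  define \<epsilon> where "\<epsilon> = 1 / sqrt \<mu>"
  have \<epsilon>: "\<epsilon> > 0" "\<mu> * \<epsilon> = sqrt \<mu>"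
    using \<mu> by (auto simp: \<epsilon>_def real_div_sqrt)
  have s: "sqrt \<mu> > 0" using \<mu> by simp
  define l where "l = max p (z - \<epsilon>)"
  define r where "r = min q (z + \<epsilon>)"
  have lr: "p \<le> l" "l \<le> z" "z \<le> r" "r \<le> q" "r - l \<le> 2 * \<epsilon>"
    using z \<epsilon> by (auto simp: l_def r_def)
  have int: "?f integrable_on {p..q}"
    using cont by (auto intro!: integrable_continuous_interval continuous_intros)
  have split: "integral {p..q} ?f = integral {p..l} ?f + integral {l..r} ?f + integral {r..q} ?f"
    using lr int
    by (simp add: Henstock_Kurzweil_Integration.integral_combine
        integrable_on_subinterval[OF int])
  have mid: "norm (integral {l..r} ?f) \<le> 2 * M / sqrt \<mu>"
  proof -
    have "norm (integral {l..r} ?f) \<le> M * (r - l)"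
      using lr M by (intro integral_bound continuous_intros continuous_on_subset[OF cont(1)]
          continuous_on_subset[OF cont(3)]) auto
    also have "\<dots> \<le> M * (2 * \<epsilon>)" by (intro mult_left_mono lr M0)
    finally show ?thesis by (simp add: \<epsilon>_def mult.commute)
  qed
  have right: "norm (integral {r..q} ?f) \<le> (3 * M + M' * (q - p)) / sqrt \<mu>"
  proof (cases "r = q")
    case True
    then show ?thesis using M0 M'0 pq s by simp
  next
    case False
    \<comment> \<open>Now \<open>z\<close> is not the right endpoint, so the choice of
      \<open>z\<close> gives \<open>\<psi>1 z \<ge> 0\<close>, and \<open>incr\<close> yields
      \<open>\<psi>1 \<ge> \<mu> * \<epsilon> = sqrt \<mu>\<close> to the right of the
      window.\<close>
    then have r: "r = z + \<epsilon>" "z < q" using lr \<epsilon> by (auto simp: r_def min_def split: if_splits)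
    have sub: "v \<in> {p..q}" if "v \<in> {r..q}" for v using that lr by auto
    have "norm (integral {r..q} ?f) \<le> (3 * M + M' * (q - r)) / sqrt \<mu>"
    proof (rule van_der_corput_first[where ?\<psi>1.0 = \<psi>1 and ?\<psi>2.0 = \<psi>2 and ?A1.0 = A1])
      fix v assume v: "v \<in> {r..q}"
      have "\<mu> * \<epsilon> \<le> \<mu> * (v - z)" using v r \<mu> by (intro mult_left_mono) auto
      also have "\<dots> \<le> \<psi>1 v" using incr[of z v] v r z \<epsilon> by auto
      finally show "sqrt \<mu> \<le> \<psi>1 v" using \<epsilon> by simp
    next
      fix v assume "v \<in> {r..q}"
      then show "0 \<le> \<psi>2 v" using lower[OF sub] \<mu> by force
    qed (use lr s d\<psi> d\<psi>1 dA M M' sub in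
        \<open>auto intro: continuous_on_subset[OF c2] continuous_on_subset[OF cA1]\<close>)
    also have "\<dots> \<le> (3 * M + M' * (q - p)) / sqrt \<mu>"
      using lr M'0 s by (intro divide_right_mono add_left_mono mult_left_mono) auto
    finally show ?thesis .
  qed
  have left: "norm (integral {p..l} ?f) \<le> (3 * M + M' * (q - p)) / sqrt \<mu>"
  proof (cases "l = p")
    case True
    then show ?thesis using M0 M'0 pq s by simp
  next
    case False
    then have l: "l = z - \<epsilon>" "p < z" using lr \<epsilon> by (auto simp: l_def max_def split: if_splits)
    have sub: "- v \<in> {p..q}" if "v \<in> {- l..- p}" for v using that lr by auto
    \<comment> \<open>Left of the window \<open>\<psi>1\<close> is negative. Reflecting v to -v
      changes the sign of the first derivative and keeps that of the second, so the first-derivative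
      test applies to the reflected integral.\<close>
    have refl: "(g \<circ> uminus has_real_derivative - D) (at v)"
      if "(g has_real_derivative D) (at (- v))" for g :: "real \<Rightarrow> real" and D v
      using DERIV_chain[OF that DERIV_minus[OF DERIV_ident]] by simp
    have cont_refl: "continuous_on {- l..- p} (g \<circ> uminus)"
      if "continuous_on {p..q} g" for g :: "real \<Rightarrow> real"
      by (intro continuous_on_compose continuous_on_subset[OF that] continuous_intros) (use sub in force)
    have "norm (integral {- l..- p} (\<lambda>v. (A \<circ> uminus) v *\<^sub>R cis ((\<psi> \<circ> uminus) v)))
        \<le> (3 * M + M' * (- p - - l)) / sqrt \<mu>"
    proof (rule van_der_corput_first[where ?\<psi>1.0 = "\<lambda>v. - (\<psi>1 \<circ> uminus) v" and ?\<psi>2.0 = "\<psi>2 \<circ> uminus"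
          and ?A1.0 = "\<lambda>v. - (A1 \<circ> uminus) v"])
      fix v assume v: "v \<in> {- l..- p}"
      have "\<mu> * \<epsilon> \<le> \<mu> * (z - - v)" using v l \<mu> by (intro mult_left_mono) auto
      also have "\<dots> \<le> - (\<psi>1 \<circ> uminus) v" using incr[of "- v" z] v l z \<epsilon> by auto
      finally show "sqrt \<mu> \<le> - (\<psi>1 \<circ> uminus) v" using \<epsilon> by simp
    next
      fix v assume "v \<in> {- l..- p}"
      then show "0 \<le> (\<psi>2 \<circ> uminus) v" using lower[OF sub] \<mu> by force
    next
      fix v assume v: "v \<in> {- l..- p}"
      show "(\<psi> \<circ> uminus has_real_derivative - (\<psi>1 \<circ> uminus) v) (at v)"
        using refl[OF d\<psi>[OF sub[OF v]]] by simp
      show "((\<lambda>v. - (\<psi>1 \<circ> uminus) v) has_real_derivative (\<psi>2 \<circ> uminus) v) (at v)"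
        using DERIV_minus[OF refl[OF d\<psi>1[OF sub[OF v]]]] by simp
      show "(A \<circ> uminus has_real_derivative - (A1 \<circ> uminus) v) (at v)"
        using refl[OF dA[OF sub[OF v]]] by simp
    qed (use lr s M M' sub cont_refl[OF c2] cont_refl[OF cA1] in
        \<open>auto intro!: continuous_on_minus simp: o_def\<close>)
    moreover have "integral {- l..- p} (\<lambda>v. (A \<circ> uminus) v *\<^sub>R cis ((\<psi> \<circ> uminus) v)) = integral {p..l} ?f"
      using Henstock_Kurzweil_Integration.integral_reflect_real[of l p ?f] by (simp add: o_def)
    moreover have "(3 * M + M' * (- p - - l)) / sqrt \<mu> \<le> (3 * M + M' * (q - p)) / sqrt \<mu>"
      using lr M'0 s by (intro divide_right_mono add_left_mono mult_left_mono) auto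
    ultimately show ?thesis by simp
  qed
  have "norm (integral {p..q} ?f) \<le> norm (integral {p..l} ?f) + norm (integral {l..r} ?f)
      + norm (integral {r..q} ?f)"
    unfolding split by (smt (verit) norm_triangle_ineq)
  also have "\<dots> \<le> (3 * M + M' * (q - p)) / sqrt \<mu> + 2 * M / sqrt \<mu> + (3 * M + M' * (q - p)) / sqrt \<mu>"
    by (intro add_mono left mid right)
  \<comment> \<open>The count is \<open>8 = 3 + 2 + 3\<close>: two outer pieces by the
    first-derivative test and a window of length at most \<open>2 / sqrt \<mu>\<close>.\<close>
  also have "\<dots> = (8 * M + 2 * M' * (q - p)) / sqrt \<mu>"
    by (simp add: add_divide_distrib[symmetric] algebra_simps)
  finally show ?thesis .
qed

text \<open>Complex conjugation negates the phase and preserves the norm, which reduces a negative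
  second derivative to a positive one.\<close>

lemma van_der_corput_second_abs:
  fixes \<psi> \<psi>1 \<psi>2 A A1 :: "real \<Rightarrow> real"
  assumes pq: "p \<le> q" and \<mu>: "\<mu> > 0"
    and d\<psi>: "\<And>v. v \<in> {p..q} \<Longrightarrow> (\<psi> has_real_derivative \<psi>1 v) (at v)"
    and d\<psi>1: "\<And>v. v \<in> {p..q} \<Longrightarrow> (\<psi>1 has_real_derivative \<psi>2 v) (at v)"
    and dA: "\<And>v. v \<in> {p..q} \<Longrightarrow> (A has_real_derivative A1 v) (at v)"
    and c2: "continuous_on {p..q} \<psi>2" and cA1: "continuous_on {p..q} A1"
    and lower: "(\<forall>v\<in>{p..q}. \<psi>2 v \<ge> \<mu>) \<or> (\<forall>v\<in>{p..q}. \<psi>2 v \<le> - \<mu>)"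
    and M: "\<And>v. v \<in> {p..q} \<Longrightarrow> \<bar>A v\<bar> \<le> M"
    and M': "\<And>v. v \<in> {p..q} \<Longrightarrow> \<bar>A1 v\<bar> \<le> M'"
  shows "norm (integral {p..q} (\<lambda>v. A v *\<^sub>R cis (\<psi> v))) \<le> (8 * M + 2 * M' * (q - p)) / sqrt \<mu>"
  using lower
proof
  assume "\<forall>v\<in>{p..q}. \<psi>2 v \<ge> \<mu>"
  then show ?thesis
    by (intro van_der_corput_second[of p q \<mu> \<psi> \<psi>1 \<psi>2 A A1] assms) auto
next
  assume neg: "\<forall>v\<in>{p..q}. \<psi>2 v \<le> - \<mu>"
  have "\<mu> \<le> - \<psi>2 v" if "v \<in> {p..q}" for v using neg that by force
  then have "norm (integral {p..q} (\<lambda>v. A v *\<^sub>R cis (- \<psi> v))) \<le> (8 * M + 2 * M' * (q - p)) / sqrt \<mu>"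
    by (intro van_der_corput_second[where ?\<psi>1.0 = "\<lambda>v. - \<psi>1 v" and ?\<psi>2.0 = "\<lambda>v. - \<psi>2 v" and ?A1.0 = A1]
        assms DERIV_minus continuous_intros) auto
  moreover have "integral {p..q} (\<lambda>v. A v *\<^sub>R cis (- \<psi> v)) = cnj (integral {p..q} (\<lambda>v. A v *\<^sub>R cis (\<psi> v)))"
    by (simp add: integral_cnj cis_cnj)
  ultimately show ?thesis by simp
qed

section \<open>Oscillatory integrals over boxes\<close>

text \<open>The shear (u, v) to (u + s v, v) preserves area, so Fubini writes the integral over the
  box as an integral over u of the slices in direction (s, 1). The factor multiplying
  \<open>B\<close> is the length of the interval of those u whose slice can meet the box.\<close>

lemma norm_integral_box_le_sheared_slices:
  fixes f :: "real \<times> real \<Rightarrow> 'a::euclidean_space"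
  assumes cont: "continuous_on UNIV f" and le: "a1 \<le> b1" "a2 \<le> b2" and B: "0 \<le> B"
    and slice: "\<And>u c d. c \<le> d \<Longrightarrow> (\<And>v. v \<in> {c..d} \<Longrightarrow> (u + s * v, v) \<in> cbox (a1, a2) (b1, b2)) \<Longrightarrow>
      norm (integral {c..d} (\<lambda>v. f (u + s * v, v))) \<le> B"
  shows "norm (integral (cbox (a1, a2) (b1, b2)) f) \<le> B * ((b1 - a1) + \<bar>s\<bar> * (b2 - a2))"
proof -
  define Q where "Q = cbox (a1, a2) (b1, b2)"
  define Q' where "Q' = (\<lambda>z. (fst z - s * snd z, snd z)) ` Q"
  \<comment> \<open>\<open>F\<close> extends \<open>f\<close> by zero from the box to the plane and
    \<open>G\<close> is \<open>F\<close> in sheared coordinates; \<open>Q'\<close> is the support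
    region of \<open>G\<close>.\<close>
  define F where "F z = indicator Q z *\<^sub>R f z" for z
  define G where "G z = F (fst z + s * snd z, snd z)" for z
  have iF: "integrable lborel F"
    unfolding F_def Q_def by (intro borel_integrable_compact continuous_on_subset[OF cont]) auto
  have Q': "(u + s * v, v) \<in> Q \<longleftrightarrow> (u, v) \<in> Q'" for u v
    unfolding Q'_def by (force simp: image_iff)
  have cG: "continuous_on S (\<lambda>z. f (fst z + s * snd z, snd z))" for S
    by (rule continuous_on_compose2[OF cont]) (auto intro!: continuous_intros)
  have "compact Q'"
    unfolding Q'_def Q_def by (intro compact_continuous_image continuous_intros) auto
  moreover have G_eq: "G = (\<lambda>z. indicator Q' z *\<^sub>R f (fst z + s * snd z, snd z))"
    using Q' by (auto simp: G_def F_def fun_eq_iff indicator_def)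
  ultimately have iG: "integrable lborel G"
    by (simp only:) (intro borel_integrable_compact cG)
  have iG': "integrable (lborel \<Otimes>\<^sub>M lborel) (\<lambda>(u, v). G (u, v))"
    using iG by (simp add: lborel_prod)
  have "integral Q f = (\<integral>z. F z \<partial>lborel)"
    using set_borel_integral_eq_integral(2)[of Q f] iF
    by (simp add: F_def[abs_def] set_integrable_def set_lebesgue_integral_def)
  also have "\<dots> = (\<integral>y. \<integral>x. F (x, y) \<partial>lborel \<partial>lborel)"
    using lborel_pair.integral_snd[of "\<lambda>x y. F (x, y)"] iF by (simp add: lborel_prod)
  also have "\<dots> = (\<integral>v. \<integral>u. G (u, v) \<partial>lborel \<partial>lborel)"
  proof (rule Bochner_Integration.integral_cong[OF refl])
    fix v
    \<comment> \<open>For fixed \<open>v\<close> the shear is only a translation by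
      \<open>s * v\<close>, so translation invariance replaces a planar change of variables.\<close>
    show "(\<integral>x. F (x, v) \<partial>lborel) = (\<integral>u. G (u, v) \<partial>lborel)"
      using lborel_integral_real_affine[of 1 "\<lambda>x. F (x, v)" "s * v"]
      by (simp add: G_def add.commute)
  qed
  also have "\<dots> = (\<integral>u. \<integral>v. G (u, v) \<partial>lborel \<partial>lborel)"
    using lborel_pair.Fubini_integral[of "\<lambda>u v. G (u, v)"] iG' by simp
  finally have eq: "integral Q f = (\<integral>u. \<integral>v. G (u, v) \<partial>lborel \<partial>lborel)" .
  define lo hi where "lo = a1 - max (s * a2) (s * b2)" and "hi = b1 - min (s * a2) (s * b2)"
  have "hi - lo = (b1 - a1) + \<bar>s * b2 - s * a2\<bar>" by (auto simp: lo_def hi_def)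
  also have "\<bar>s * b2 - s * a2\<bar> = \<bar>s\<bar> * (b2 - a2)"
    using le by (simp add: right_diff_distrib[symmetric] abs_mult)
  finally have hilo: "hi - lo = (b1 - a1) + \<bar>s\<bar> * (b2 - a2)" .
  moreover have "0 \<le> \<bar>s\<bar> * (b2 - a2)" using le by simp
  ultimately have "lo \<le> hi" using le by linarith
  have bound: "norm (\<integral>v. G (u, v) \<partial>lborel) \<le> indicator {lo..hi} u * B" for u
  proof -
    \<comment> \<open>A line meets a box in a compact convex set, hence in a possibly empty interval
      \<open>{c..d}\<close>; this puts the slice into the form that \<open>slice\<close>
      treats.\<close>
    define I where "I = {v. (u + s * v, v) \<in> Q}"
    have I_eq: "I = {v. a1 \<le> u + s * v \<and> u + s * v \<le> b1} \<inter> {a2..b2}"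
      by (auto simp: I_def Q_def)
    have "{v. a1 \<le> u + s * v \<and> u + s * v \<le> b1} = (\<lambda>v. s *\<^sub>R v) -` {a1 - u..b1 - u}"
      by auto
    moreover have "convex ((\<lambda>v. s *\<^sub>R v) -` {a1 - u..b1 - u})"
      by (rule convex_linear_vimage[OF linear_scaleR]) simp
    ultimately have "convex I" unfolding I_eq by (simp add: convex_Int)
    moreover have "compact I"
      unfolding I_eq by (intro closed_Int_compact closed_Collect_conj closed_Collect_le continuous_intros) auto
    ultimately obtain c d where I: "I = {c..d}"
      using is_interval_compact[of I] by (auto simp: is_interval_convex_1)
    have G_I: "(\<integral>v. G (u, v) \<partial>lborel) = integral {c..d} (\<lambda>v. f (u + s * v, v))"
    proof -
      have "set_integrable lborel {c..d} (\<lambda>v. f (u + s * v, v))"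
        unfolding set_integrable_def
        by (intro borel_integrable_compact continuous_on_compose2[OF cont] continuous_intros) auto
      then have "(LINT v:{c..d}|lborel. f (u + s * v, v)) = integral {c..d} (\<lambda>v. f (u + s * v, v))"
        by (rule set_borel_integral_eq_integral)
      moreover have "G (u, v) = indicator {c..d} v *\<^sub>R f (u + s * v, v)" for v
        unfolding I[symmetric] by (simp add: G_def F_def I_def indicator_def)
      ultimately show ?thesis by (simp add: set_lebesgue_integral_def)
    qed
    show ?thesis
    proof (cases "c \<le> d")
      case False
      then show ?thesis using B by (simp add: G_I)
    next
      case True
      then have "c \<in> I" by (simp add: I)
      then have c: "a1 \<le> u + s * c" "u + s * c \<le> b1" "a2 \<le> c" "c \<le> b2" by (auto simp: I_eq)
      have "min (s * a2) (s * b2) \<le> s * c \<and> s * c \<le> max (s * a2) (s * b2)"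
      proof (cases "s \<ge> 0")
        case True
        then have "s * a2 \<le> s * c" "s * c \<le> s * b2" using c by (auto intro: mult_left_mono)
        then show ?thesis by linarith
      next
        case False
        then have "s * c \<le> s * a2" "s * b2 \<le> s * c" using c by (auto intro: mult_left_mono_neg)
        then show ?thesis by linarith
      qed
      then have "u \<in> {lo..hi}" using c by (auto simp: lo_def hi_def)
      moreover have "norm (integral {c..d} (\<lambda>v. f (u + s * v, v))) \<le> B"
      proof (rule slice[OF True])
        fix v assume "v \<in> {c..d}"
        then have "v \<in> I" by (simp only: I)
        then show "(u + s * v, v) \<in> cbox (a1, a2) (b1, b2)" unfolding I_def Q_def by blast
      qed
      ultimately show ?thesis by (simp add: G_I)
    qed
  qed
  have "norm (integral Q f) \<le> (\<integral>u. indicator {lo..hi} u * B \<partial>lborel)"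
    unfolding eq
  proof (rule Bochner_Integration.integral_norm_bound_integral)
    show "integrable lborel (\<lambda>u. \<integral>v. G (u, v) \<partial>lborel)"
      using lborel_pair.integrable_fst[OF iG'] by simp
    show "integrable lborel (\<lambda>u. indicator {lo..hi} u * B)"
      by (intro integrable_mult_left integrable_real_indicator) (auto simp: emeasure_lborel_Icc_eq)
  qed (use bound in auto)
  also have "\<dots> = B * (hi - lo)" using \<open>lo \<le> hi\<close> by simp
  finally show ?thesis by (simp add: hilo Q_def)
qed

text \<open>The symbol of the negative discrete Laplacian up to scaling. By the half-angle formula
  it is twice the sum of squared sines in the kernel, so the phase of the kernel becomes a multiple
  of \<open>\<omega>\<^sup>2\<close>.\<close>

definition \<omega> :: "real \<times> real \<Rightarrow> real" where
  "\<omega> z = 2 - cos (fst z) - cos (snd z)"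

text \<open>The second derivative of \<open>\<omega>\<^sup>2\<close> along the direction \<open>(s, 1)\<close>.\<close>

definition hess :: "real \<Rightarrow> real \<times> real \<Rightarrow> real" where
  "hess s z = 2 * (s * sin (fst z) + sin (snd z))\<^sup>2 + 2 * \<omega> z * (s\<^sup>2 * cos (fst z) + cos (snd z))"

text \<open>Isolates what the oscillatory estimates use of the cutoff: first-order bounds by one
  constant \<open>M\<close>, vanishing near the degenerate point 0, and bounded support.
  \<open>ax\<close> and \<open>ay\<close> are the partial derivatives of \<open>a\<close>.\<close>

locale amplitude =
  fixes a ax ay :: "real \<times> real \<Rightarrow> real" and M :: real
  assumes deriv: "\<And>z. (a has_derivative (\<lambda>h. ax z * fst h + ay z * snd h)) (at z)"
    and cont_ax: "continuous_on UNIV ax" and cont_ay: "continuous_on UNIV ay"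
    and vanish_inner: "\<And>z. z \<in> cbox (- pi, - pi) (pi, pi) \<Longrightarrow> a z = 0"
    and vanish_outer: "\<And>z. z \<notin> cbox (- (4 * pi), - (4 * pi)) (4 * pi, 4 * pi) \<Longrightarrow> a z = 0"
    and le_M: "\<And>z. \<bar>a z\<bar> \<le> M" "\<And>z. \<bar>ax z\<bar> \<le> M" "\<And>z. \<bar>ay z\<bar> \<le> M"
begin

text \<open>The integrand after rescaling. The linear coefficients \<open>p\<close> and
  \<open>q\<close> are arbitrary reals, so that a bound uniform in them is uniform in the spatial
  variable of the kernel.\<close>

definition osc :: "real \<Rightarrow> real \<Rightarrow> real \<Rightarrow> real \<Rightarrow> real \<times> real \<Rightarrow> complex" where
  "osc N p q \<tau> z = a ((1 / N) *\<^sub>R z) *\<^sub>R cis (p * fst z + q * snd z + \<tau> * (\<omega> z)\<^sup>2)"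

lemma M_nonneg: "0 \<le> M"
  using le_M(1)[of 0] by linarith

lemma cont_a: "continuous_on UNIV a"
  by (intro continuous_at_imp_continuous_on ballI has_derivative_continuous[OF deriv])

lemma cont_osc: "continuous_on S (osc N p q \<tau>)"
  unfolding osc_def \<omega>_def
  by (intro continuous_intros continuous_on_compose2[OF cont_a]) auto

text \<open>Along (s, 1) the linear phase has no second derivative, so that of the whole phase is
  \<open>\<tau> * hess s\<close> and the second-derivative test applies on each slice with
  \<open>\<mu> = \<bar>\<tau>\<bar> * c\<close>. The chain rule bounds the derivative of the
  rescaled amplitude by \<open>2 * M / N\<close>, because
  \<open>\<bar>s\<bar> \<le> 1\<close>.\<close>

lemma osc_box_bound:
  assumes le: "a1 \<le> b1" "a2 \<le> b2" and N: "N > 0" and \<tau>: "\<tau> \<noteq> 0" and c: "c > 0" and s: "\<bar>s\<bar> \<le> 1"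
    and hess: "(\<forall>z\<in>cbox (a1, a2) (b1, b2). hess s z \<ge> c) \<or> (\<forall>z\<in>cbox (a1, a2) (b1, b2). hess s z \<le> - c)"
  shows "norm (integral (cbox (a1, a2) (b1, b2)) (osc N p q \<tau>))
    \<le> (8 * M + 4 * (M / N) * (b2 - a2)) * ((b1 - a1) + (b2 - a2)) / sqrt (\<bar>\<tau>\<bar> * c)"
proof -
  let ?Q = "cbox (a1, a2) (b1, b2)"
  define B where "B = (8 * M + 4 * (M / N) * (b2 - a2)) / sqrt (\<bar>\<tau>\<bar> * c)"
  have \<mu>: "\<bar>\<tau>\<bar> * c > 0" using \<tau> c by simp
  have B: "0 \<le> B"
    unfolding B_def using M_nonneg N le \<mu>
    by (intro divide_nonneg_nonneg add_nonneg_nonneg mult_nonneg_nonneg) auto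
  have "norm (integral ?Q (osc N p q \<tau>)) \<le> B * ((b1 - a1) + \<bar>s\<bar> * (b2 - a2))"
  proof (rule norm_integral_box_le_sheared_slices[OF cont_osc le B])
    fix u l r :: real
    assume lr: "l \<le> r" and sub: "\<And>v. v \<in> {l..r} \<Longrightarrow> (u + s * v, v) \<in> ?Q"
    define \<psi> where "\<psi> v = p * (u + s * v) + q * v + \<tau> * (\<omega> (u + s * v, v))\<^sup>2" for v
    define \<psi>1 where "\<psi>1 v = p * s + q + \<tau> * (2 * \<omega> (u + s * v, v) * (s * sin (u + s * v) + sin v))" for v
    define \<psi>2 where "\<psi>2 v = \<tau> * hess s (u + s * v, v)" for v
    define A where "A v = a ((1 / N) *\<^sub>R (u + s * v, v))" for v
    define A1 where "A1 v = (s * ax ((1 / N) *\<^sub>R (u + s * v, v)) + ay ((1 / N) *\<^sub>R (u + s * v, v))) / N" for v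
    have "norm (integral {l..r} (\<lambda>v. A v *\<^sub>R cis (\<psi> v)))
        \<le> (8 * M + 2 * (2 * M / N) * (r - l)) / sqrt (\<bar>\<tau>\<bar> * c)"
    proof (rule van_der_corput_second_abs[OF lr \<mu>])
      fix v
      show "(\<psi> has_real_derivative \<psi>1 v) (at v)"
        unfolding \<psi>_def \<psi>1_def \<omega>_def
        by (auto intro!: derivative_eq_intros simp: algebra_simps)
      show "(\<psi>1 has_real_derivative \<psi>2 v) (at v)"
        unfolding \<psi>1_def \<psi>2_def \<omega>_def hess_def
        by (auto intro!: derivative_eq_intros simp: algebra_simps power2_eq_square)
      have "((\<lambda>v. (1 / N) *\<^sub>R (u + s * v, v)) has_derivative (\<lambda>h. (1 / N) *\<^sub>R (s * h, h))) (at v)"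
        using N by (auto intro!: derivative_eq_intros)
      from has_derivative_compose[OF this deriv]
      have "(A has_derivative (\<lambda>h. ax ((1 / N) *\<^sub>R (u + s * v, v)) * (1 / N * (s * h))
          + ay ((1 / N) *\<^sub>R (u + s * v, v)) * (1 / N * h))) (at v)"
        by (simp add: A_def[abs_def])
      then show "(A has_real_derivative A1 v) (at v)"
        unfolding has_field_derivative_def A1_def
        by (rule has_derivative_eq_rhs) (use N in \<open>auto simp: field_simps\<close>)
      show "\<bar>A v\<bar> \<le> M" by (simp only: A_def le_M)
      have "\<bar>s * ax w + ay w\<bar> \<le> 2 * M" for w
      proof -
        have "\<bar>s * ax w\<bar> \<le> 1 * M" unfolding abs_mult using s le_M by (intro mult_mono) auto
        then show ?thesis using le_M(3)[of w] by linarith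
      qed
      then show "\<bar>A1 v\<bar> \<le> 2 * M / N"
        unfolding A1_def using N by (simp add: divide_right_mono)
    next
      show "continuous_on {l..r} \<psi>2"
        unfolding \<psi>2_def hess_def \<omega>_def by (intro continuous_intros)
      show "continuous_on {l..r} A1"
        unfolding A1_def
        by (intro continuous_intros continuous_on_compose2[OF cont_ax] continuous_on_compose2[OF cont_ay])
          (use N in auto)
      have pos: "\<bar>\<tau>\<bar> * c \<le> \<bar>\<tau>\<bar> * t" if "c \<le> t" for t using that by (simp add: mult_left_mono)
      have neg: "\<bar>\<tau>\<bar> * t \<le> - (\<bar>\<tau>\<bar> * c)" if "t \<le> - c" for t
        using mult_left_mono[OF that, of "\<bar>\<tau>\<bar>"] by simp
      \<comment> \<open>A negative \<tau> exchanges the two sign alternatives of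
        \<open>hess\<close>.\<close>
      from hess show "(\<forall>v\<in>{l..r}. \<psi>2 v \<ge> \<bar>\<tau>\<bar> * c) \<or> (\<forall>v\<in>{l..r}. \<psi>2 v \<le> - (\<bar>\<tau>\<bar> * c))"
      proof
        assume h: "\<forall>z\<in>?Q. hess s z \<ge> c"
        then have "\<bar>\<tau>\<bar> * c \<le> \<bar>\<tau>\<bar> * hess s (u + s * v, v)" if "v \<in> {l..r}" for v
          using pos sub[OF that] by blast
        then show ?thesis unfolding \<psi>2_def by (cases "\<tau> > 0") force+
      next
        assume h: "\<forall>z\<in>?Q. hess s z \<le> - c"
        then have "\<bar>\<tau>\<bar> * hess s (u + s * v, v) \<le> - (\<bar>\<tau>\<bar> * c)" if "v \<in> {l..r}" for v
          using neg sub[OF that] by blast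
        then show ?thesis unfolding \<psi>2_def by (cases "\<tau> > 0") force+
      qed
    qed
    also have "(\<lambda>v. A v *\<^sub>R cis (\<psi> v)) = (\<lambda>v. osc N p q \<tau> (u + s * v, v))"
      by (simp add: A_def \<psi>_def osc_def)
    also have "(8 * M + 2 * (2 * M / N) * (r - l)) / sqrt (\<bar>\<tau>\<bar> * c) \<le> B"
    proof -
      have "r - l \<le> b2 - a2" using sub[of l] sub[of r] lr by auto
      then have "4 * (M / N) * (r - l) \<le> 4 * (M / N) * (b2 - a2)"
        using M_nonneg N by (intro mult_left_mono) auto
      then show ?thesis unfolding B_def using \<mu> by (intro divide_right_mono) auto
    qed
    finally show "norm (integral {l..r} (\<lambda>v. osc N p q \<tau> (u + s * v, v))) \<le> B" .
  qed
  also have "\<dots> \<le> B * ((b1 - a1) + (b2 - a2))"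
    using mult_right_mono[OF s, of "b2 - a2"] le B by (intro mult_left_mono add_left_mono) auto
  finally show ?thesis by (simp add: B_def)
qed

end

section \<open>Non-degeneracy of the phase, and preparations for cutting up the domain\<close>

text \<open>\<open>hess s z\<close> is a quadratic polynomial in \<open>s\<close>; vanishing at 0, 1
  and -1 kills all three coefficients. The mixed one makes one of the sines zero, where the cosine
  is not, and the corresponding pure one then forces \<open>\<omega> z = 0\<close>, which holds in
  this box only at the origin.\<close>

lemma ex_hess_nonzero:
  assumes z: "z \<in> cbox (- pi, - pi) (pi, pi)" "z \<noteq> 0"
  shows "\<exists>s. \<bar>s\<bar> \<le> 1 \<and> hess s z \<noteq> 0"
proof (rule ccontr)
  assume "\<not> ?thesis"
  then have "hess 0 z = 0" "hess 1 z = 0" "hess (- 1) z = 0" by auto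
  moreover have "hess 0 z = 2 * ((sin (snd z))\<^sup>2 + \<omega> z * cos (snd z))"
    "hess 1 z + hess (- 1) z = 2 * hess 0 z + 4 * ((sin (fst z))\<^sup>2 + \<omega> z * cos (fst z))"
    "hess 1 z - hess (- 1) z = 8 * (sin (fst z) * sin (snd z))"
    by (simp_all add: hess_def power2_eq_square algebra_simps)
  ultimately have y: "(sin (snd z))\<^sup>2 + \<omega> z * cos (snd z) = 0"
    and x: "(sin (fst z))\<^sup>2 + \<omega> z * cos (fst z) = 0"
    and xy: "sin (fst z) * sin (snd z) = 0"
    by simp_all
  have zero: "cos t \<noteq> 0" if "sin t = 0" for t :: real
    using sin_cos_squared_add[of t] that by auto
  have "\<omega> z = 0"
    using xy x y zero by (cases "sin (fst z) = 0") auto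
  then have "cos (fst z) = 1" "cos (snd z) = 1"
    using cos_le_one[of "fst z"] cos_le_one[of "snd z"] unfolding \<omega>_def by linarith+
  moreover have "t = 0" if "cos t = 1" "- pi \<le> t" "t \<le> pi" for t :: real
  proof -
    have "arccos (cos \<bar>t\<bar>) = \<bar>t\<bar>" using that by (intro arccos_cos) auto
    then show ?thesis using that by simp
  qed
  moreover have "- pi \<le> fst z" "fst z \<le> pi" "- pi \<le> snd z" "snd z \<le> pi"
    using z(1) by (cases z; auto)+
  ultimately show False using z(2) by (simp add: prod_eq_iff)
qed

text \<open>Integrating \<open>cos t \<ge> 1 / 2\<close> twice from 0, first to
  \<open>sin t \<ge> t / 2\<close>, gives the claim; evenness covers negative
  \<open>x\<close>.\<close>

lemma one_minus_cos_ge: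
  fixes x :: real
  assumes "\<bar>x\<bar> \<le> pi / 3"
  shows "1 - cos x \<ge> x\<^sup>2 / 4"
proof -
  have cos: "cos t \<ge> 1 / 2" if "0 \<le> t" "t \<le> pi / 3" for t :: real
    using cos_monotone_0_pi_le[of t "pi / 3"] that cos_60 by simp
  have sin: "sin t - t / 2 \<ge> 0" if t: "0 \<le> t" "t \<le> pi / 3" for t :: real
  proof -
    have "sin 0 - 0 / 2 \<le> sin t - t / 2"
    proof (rule DERIV_nonneg_imp_nondecreasing[OF t(1)])
      fix u assume "0 \<le> u" "u \<le> t"
      then show "\<exists>y. ((\<lambda>t. sin t - t / 2) has_real_derivative y) (at u) \<and> 0 \<le> y"
        using cos[of u] t by (intro exI[of _ "cos u - 1 / 2"]) (auto intro!: derivative_eq_intros)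
    qed
    then show ?thesis by simp
  qed
  have "- cos 0 - 0\<^sup>2 / 4 \<le> - cos \<bar>x\<bar> - \<bar>x\<bar>\<^sup>2 / 4"
  proof (rule DERIV_nonneg_imp_nondecreasing[where f = "\<lambda>t. - cos t - t\<^sup>2 / 4"])
    fix u assume "0 \<le> u" "u \<le> \<bar>x\<bar>"
    then show "\<exists>y. ((\<lambda>t. - cos t - t\<^sup>2 / 4) has_real_derivative y) (at u) \<and> 0 \<le> y"
      using sin[of u] assms by (intro exI[of _ "sin u - u / 2"]) (auto intro!: derivative_eq_intros)
  qed simp
  then show ?thesis by simp
qed

lemma integral_split_fst:
  fixes f :: "real \<times> real \<Rightarrow> 'a::banach"
  assumes "continuous_on UNIV f" "a1 \<le> m" "m \<le> b1"
  shows "integral (cbox (a1, a2) (b1, b2)) f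
    = integral (cbox (a1, a2) (m, b2)) f + integral (cbox (m, a2) (b1, b2)) f"
proof -
  have "f integrable_on cbox (a1, a2) (b1, b2)"
    by (intro integrable_continuous continuous_on_subset[OF assms(1)]) auto
  from Henstock_Kurzweil_Integration.integral_split[OF this, of "(1, 0)" m]
  have "integral (cbox (a1, a2) (b1, b2)) f =
      integral (cbox (a1, a2) (b1, b2) \<inter> {x. x \<bullet> (1, 0) \<le> m}) f
      + integral (cbox (a1, a2) (b1, b2) \<inter> {x. m \<le> x \<bullet> (1, 0)}) f"
    by (simp add: Basis_prod_def)
  moreover have "cbox (a1, a2) (b1, b2) \<inter> {x. x \<bullet> (1, 0) \<le> m} = cbox (a1, a2) (m, b2)"
    "cbox (a1, a2) (b1, b2) \<inter> {x. m \<le> x \<bullet> (1, 0)} = cbox (m, a2) (b1, b2)"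
    using assms by auto
  ultimately show ?thesis by simp
qed

lemma integral_split_snd:
  fixes f :: "real \<times> real \<Rightarrow> 'a::banach"
  assumes "continuous_on UNIV f" "a2 \<le> m" "m \<le> b2"
  shows "integral (cbox (a1, a2) (b1, b2)) f
    = integral (cbox (a1, a2) (b1, m)) f + integral (cbox (a1, m) (b1, b2)) f"
proof -
  have "f integrable_on cbox (a1, a2) (b1, b2)"
    by (intro integrable_continuous continuous_on_subset[OF assms(1)]) auto
  from Henstock_Kurzweil_Integration.integral_split[OF this, of "(0, 1)" m]
  have "integral (cbox (a1, a2) (b1, b2)) f =
      integral (cbox (a1, a2) (b1, b2) \<inter> {x. x \<bullet> (0, 1) \<le> m}) f
      + integral (cbox (a1, a2) (b1, b2) \<inter> {x. m \<le> x \<bullet> (0, 1)}) f"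
    by (simp add: Basis_prod_def)
  moreover have "cbox (a1, a2) (b1, b2) \<inter> {x. x \<bullet> (0, 1) \<le> m} = cbox (a1, a2) (b1, m)"
    "cbox (a1, a2) (b1, b2) \<inter> {x. m \<le> x \<bullet> (0, 1)} = cbox (a1, m) (b1, b2)"
    using assms by auto
  ultimately show ?thesis by simp
qed

section \<open>Bounds for the rescaled integral, uniform in frequency scale and linear phase\<close>

context amplitude
begin

lemma osc_vanish_inner:
  assumes "N > 0" "\<bar>fst z\<bar> \<le> pi * N" "\<bar>snd z\<bar> \<le> pi * N"
  shows "osc N p q \<tau> z = 0"
proof -
  have "(1 / N) *\<^sub>R z \<in> cbox (- pi, - pi) (pi, pi)"
    using assms by (cases z) (auto simp: field_simps abs_le_iff)
  then show ?thesis by (simp add: osc_def vanish_inner)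
qed

lemma osc_vanish_outer:
  assumes "N > 0" "z \<notin> cbox (- (4 * pi * N), - (4 * pi * N)) (4 * pi * N, 4 * pi * N)"
  shows "osc N p q \<tau> z = 0"
proof -
  have "(1 / N) *\<^sub>R z \<notin> cbox (- (4 * pi), - (4 * pi)) (4 * pi, 4 * pi)"
    using assms by (cases z) (auto simp: field_simps)
  then show ?thesis by (simp add: osc_def vanish_outer)
qed

text \<open>The local half of the compactness argument, phrased for boxes containing
  \<open>x\<close> inside a ball about \<open>x\<close> so that it matches tagged divisions. The
  radius and the constant depend on \<open>x\<close> only: at the origin the amplitude vanishes
  nearby, elsewhere the sign of a nonzero \<open>hess s\<close> persists by continuity.\<close>

lemma osc_local_bound:
  assumes x: "x \<in> cbox (- pi, - pi) (pi, pi)"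
  shows "\<exists>e C. 0 < e \<and> (\<forall>K N p q \<tau>. (\<exists>c d. K = cbox c d) \<longrightarrow> x \<in> K \<longrightarrow> K \<subseteq> ball x e \<longrightarrow>
    1 / 16 \<le> N \<longrightarrow> \<tau> \<noteq> 0 \<longrightarrow> norm (integral K (osc N p q \<tau>)) \<le> C / sqrt \<bar>\<tau>\<bar>)"
proof (cases "x = 0")
  case True
  show ?thesis
  \<comment> \<open>As \<open>N \<ge> 1 / 16\<close>, this ball lies in the square of half-side
    \<open>pi * N\<close>, where the integrand is zero.\<close>
  proof (rule exI[of _ "pi / 16"], rule exI[of _ 0], intro conjI allI impI)
    fix K and N p q \<tau> :: real
    assume K: "K \<subseteq> ball x (pi / 16)" and N: "1 / 16 \<le> N"
    have "osc N p q \<tau> z = 0" if "z \<in> K" for z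
    proof (rule osc_vanish_inner)
      have "norm z < pi / 16" using that K True by auto
      moreover have "pi / 16 \<le> pi * N" using mult_left_mono[OF N, of pi] by simp
      ultimately show "\<bar>fst z\<bar> \<le> pi * N" "\<bar>snd z\<bar> \<le> pi * N"
        using norm_fst_le[of "fst z" "snd z"] norm_snd_le[of "snd z" "fst z"]
        unfolding prod.collapse real_norm_def by linarith+
    qed (use N in linarith)
    then have "integral K (osc N p q \<tau>) = integral K (\<lambda>_. 0)"
      by (intro Henstock_Kurzweil_Integration.integral_cong)
    then show "norm (integral K (osc N p q \<tau>)) \<le> 0 / sqrt \<bar>\<tau>\<bar>" by simp
  qed simp
next
  case False
  then obtain s where s: "\<bar>s\<bar> \<le> 1" "hess s x \<noteq> 0" using ex_hess_nonzero[OF x] by blast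
  define c where "c = \<bar>hess s x\<bar> / 2"
  have c: "c > 0" using s by (simp add: c_def)
  have "isCont (hess s) x"
    unfolding hess_def \<omega>_def by (intro continuous_intros)
  then obtain e where e: "e > 0" "\<And>z. dist z x < e \<Longrightarrow> dist (hess s z) (hess s x) < c"
    using c unfolding continuous_at_eps_delta by blast
  show ?thesis
  \<comment> \<open>A box in the ball has sides at most \<open>2 * e\<close>, and
    \<open>N \<ge> 1 / 16\<close> gives \<open>4 * (M / N) \<le> 64 * M\<close>; inserting both in
    \<open>osc_box_bound\<close> produces this constant.\<close>
  proof (rule exI[of _ e], rule exI[of _ "(8 * M + 64 * M * (2 * e)) * (4 * e) / sqrt c"],
      intro conjI allI impI)
    fix K and N p q \<tau> :: real
    assume "\<exists>c d. K = cbox c d" and xK: "x \<in> K" and K: "K \<subseteq> ball x e" and N: "1 / 16 \<le> N" and \<tau>: "\<tau> \<noteq> 0"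
    then obtain a1 a2 b1 b2 where K_eq: "K = cbox (a1, a2) (b1, b2)" by auto
    have le: "a1 \<le> b1" "a2 \<le> b2" using xK unfolding K_eq by (cases x; auto)+
    have "(a1, a2) \<in> K" "(b1, b2) \<in> K" using le by (auto simp: K_eq)
    then have "dist x (a1, a2) < e" "dist x (b1, b2) < e" using K by auto
    then have "dist (b1, b2) (a1, a2) < 2 * e" by (smt (verit) dist_triangle3)
    then have diff: "b1 - a1 \<le> 2 * e" "b2 - a2 \<le> 2 * e"
      using dist_fst_le[of "(b1, b2)" "(a1, a2)"] dist_snd_le[of "(b1, b2)" "(a1, a2)"]
      by (auto simp: dist_real_def)
    have near: "\<bar>hess s z - hess s x\<bar> < c" if "z \<in> K" for z
      using e(2)[of z] that K by (auto simp: dist_real_def dist_commute)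
    have "(\<forall>z\<in>K. hess s z \<ge> c) \<or> (\<forall>z\<in>K. hess s z \<le> - c)"
    proof (cases "hess s x > 0")
      case True
      then have "hess s z \<ge> c" if "z \<in> K" for z using near[OF that] True unfolding c_def by linarith
      then show ?thesis by blast
    next
      case False
      then have "hess s z \<le> - c" if "z \<in> K" for z using near[OF that] False unfolding c_def by linarith
      then show ?thesis by blast
    qed
    then have "norm (integral K (osc N p q \<tau>))
        \<le> (8 * M + 4 * (M / N) * (b2 - a2)) * ((b1 - a1) + (b2 - a2)) / sqrt (\<bar>\<tau>\<bar> * c)"
      unfolding K_eq using N by (intro osc_box_bound[OF le _ \<tau> c s(1)]) auto
    also have "\<dots> \<le> (8 * M + 64 * M * (2 * e)) * (4 * e) / sqrt (\<bar>\<tau>\<bar> * c)"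
    proof -
      have "M \<le> 16 * M * N" using mult_left_mono[OF N M_nonneg] by simp
      then have "4 * (M / N) \<le> 64 * M" using N by (simp add: field_simps)
      then have "4 * (M / N) * (b2 - a2) \<le> 64 * M * (2 * e)"
        by (rule mult_mono[OF _ diff(2)]) (use le M_nonneg in auto)
      moreover have "(b1 - a1) + (b2 - a2) \<le> 4 * e" using diff by linarith
      ultimately show ?thesis
        by (intro divide_right_mono[OF mult_mono[OF add_left_mono]])
          (use le M_nonneg e(1) \<tau> c in auto)
    qed
    finally show "norm (integral K (osc N p q \<tau>))
        \<le> (8 * M + 64 * M * (2 * e)) * (4 * e) / sqrt c / sqrt \<bar>\<tau>\<bar>"
      by (simp add: real_sqrt_mult mult.commute)
  qed (rule e)
qed

lemma osc_bound_coarse: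
  "\<exists>C. \<forall>N p q \<tau>. 1 / 16 \<le> N \<longrightarrow> \<tau> \<noteq> 0 \<longrightarrow>
    norm (integral (cbox (- pi, - pi) (pi, pi)) (osc N p q \<tau>)) \<le> C / sqrt \<bar>\<tau>\<bar>"
proof -
  let ?P = "cbox (- pi, - pi) (pi, pi)"
  obtain e C where e: "\<And>x. x \<in> ?P \<Longrightarrow> 0 < e x"
    and C: "\<And>x K N p q \<tau>. x \<in> ?P \<Longrightarrow> \<exists>c d. K = cbox c d \<Longrightarrow> x \<in> K \<Longrightarrow> K \<subseteq> ball x (e x) \<Longrightarrow>
      1 / 16 \<le> N \<Longrightarrow> \<tau> \<noteq> 0 \<Longrightarrow> norm (integral K (osc N p q \<tau>)) \<le> C x / sqrt \<bar>\<tau>\<bar>"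
    using osc_local_bound by metis
  \<comment> \<open>A division fine for this gauge plays the role of a finite subcover; it does not depend on the parameters.\<close>
  define \<gamma> where "\<gamma> x = ball x (if x \<in> ?P then e x else 1)" for x
  have "gauge \<gamma>" using e by (auto simp: gauge_def \<gamma>_def)
  then obtain D where D: "D tagged_division_of ?P" "\<gamma> fine D"
    by (rule fine_division_exists)
  show ?thesis
  proof (intro exI allI impI)
    fix N p q \<tau> :: real
    assume N: "1 / 16 \<le> N" and \<tau>: "\<tau> \<noteq> 0"
    have "integral ?P (osc N p q \<tau>) = (\<Sum>(x, K)\<in>D. integral K (osc N p q \<tau>))"
      by (intro integral_combine_tagged_division_topdown integrable_continuous cont_osc D)
    also have "norm \<dots> \<le> (\<Sum>(x, K)\<in>D. C x / sqrt \<bar>\<tau>\<bar>)"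
    proof (rule sum_norm_le, clarify)
      fix x K
      assume xK: "(x, K) \<in> D"
      have "x \<in> ?P" using tagged_division_ofD(2,3)[OF D(1) xK] by blast
      moreover have "K \<subseteq> ball x (e x)"
        using fineD[OF D(2) xK] \<open>x \<in> ?P\<close> by (simp add: \<gamma>_def)
      ultimately show "norm (integral K (osc N p q \<tau>)) \<le> C x / sqrt \<bar>\<tau>\<bar>"
        using C N \<tau> tagged_division_ofD(2,4)[OF D(1) xK] by blast
    qed
    also have "\<dots> = (\<Sum>(x, K)\<in>D. C x) / sqrt \<bar>\<tau>\<bar>"
      by (simp add: sum_divide_distrib case_prod_unfold)
    finally show "norm (integral ?P (osc N p q \<tau>)) \<le> (\<Sum>(x, K)\<in>D. C x) / sqrt \<bar>\<tau>\<bar>" .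
  qed
qed

text \<open>The vertical direction \<open>s = 0\<close> suffices:
  \<open>cos (snd z) \<ge> 1 / 2\<close> gives \<open>hess 0 z \<ge> \<omega> z\<close>, and
  \<omega> is at least a quarter of the squared distance to the origin. The sum of the sides is at
  most \<open>16 * pi * N\<close> and the root of the lower bound is \<open>pi * N / 2\<close>, so
  \<open>N\<close> cancels and leaves the factor 32.\<close>

lemma osc_rectangle_bound:
  assumes N: "0 < N" "N \<le> 1 / 16" and \<tau>: "\<tau> \<noteq> 0" and le: "a1 \<le> b1" "a2 \<le> b2"
    and sub: "- (4 * pi * N) \<le> a1" "b1 \<le> 4 * pi * N" "- (4 * pi * N) \<le> a2" "b2 \<le> 4 * pi * N"
    and away: "\<And>z. z \<in> cbox (a1, a2) (b1, b2) \<Longrightarrow> pi * N \<le> \<bar>fst z\<bar> \<or> pi * N \<le> \<bar>snd z\<bar>"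
  shows "norm (integral (cbox (a1, a2) (b1, b2)) (osc N p q \<tau>)) \<le> 32 * (8 * M + 32 * pi * M) / sqrt \<bar>\<tau>\<bar>"
proof -
  let ?c = "(pi * N / 2)\<^sup>2"
  have c: "?c > 0" using N by simp
  \<comment> \<open>The threshold \<open>1 / 16\<close> for \<open>N\<close> serves here: it places
    the support where the quadratic lower bound for \<open>1 - cos\<close> and
    \<open>cos \<ge> 1 / 2\<close> are available.\<close>
  have small: "4 * pi * N \<le> pi / 3"
    using mult_left_mono[OF N(2), of "4 * pi"] pi_gt_zero by simp
  have "hess 0 z \<ge> ?c" if z: "z \<in> cbox (a1, a2) (b1, b2)" for z
  proof -
    have "a1 \<le> fst z" "fst z \<le> b1" "a2 \<le> snd z" "snd z \<le> b2"
      using z by (cases z; auto)+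
    then have abs: "\<bar>fst z\<bar> \<le> pi / 3" "\<bar>snd z\<bar> \<le> pi / 3"
      using sub small by linarith+
    have sq: "?c \<le> t\<^sup>2 / 4" if "pi * N \<le> \<bar>t\<bar>" for t
      using power_mono[OF that, of 2] N by (simp add: power_divide)
    have "?c \<le> (fst z)\<^sup>2 / 4 + (snd z)\<^sup>2 / 4"
      using away[OF z]
    proof
      assume "pi * N \<le> \<bar>fst z\<bar>"
      from sq[OF this] show ?thesis by (simp add: add_increasing2)
    next
      assume "pi * N \<le> \<bar>snd z\<bar>"
      from sq[OF this] show ?thesis by (simp add: add_increasing)
    qed
    also have "\<dots> \<le> \<omega> z"
      using one_minus_cos_ge[OF abs(1)] one_minus_cos_ge[OF abs(2)] by (simp add: \<omega>_def)
    finally have \<omega>: "?c \<le> \<omega> z" .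
    have "cos (pi / 3) \<le> cos \<bar>snd z\<bar>" using abs by (intro cos_monotone_0_pi_le) auto
    then have "1 / 2 \<le> cos (snd z)" by (simp add: cos_60)
    moreover have "0 \<le> \<omega> z" using \<omega> c by linarith
    ultimately have "\<omega> z * (1 / 2) \<le> \<omega> z * cos (snd z)" by (rule mult_left_mono)
    moreover have "hess 0 z = 2 * (sin (snd z))\<^sup>2 + 2 * (\<omega> z * cos (snd z))" by (simp add: hess_def)
    moreover have "0 \<le> (sin (snd z))\<^sup>2" by simp
    ultimately show ?thesis using \<omega> by linarith
  qed
  then have "norm (integral (cbox (a1, a2) (b1, b2)) (osc N p q \<tau>))
      \<le> (8 * M + 4 * (M / N) * (b2 - a2)) * ((b1 - a1) + (b2 - a2)) / sqrt (\<bar>\<tau>\<bar> * ?c)"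
    by (intro osc_box_bound[OF le N(1) \<tau> c, of 0]) auto
  also have "\<dots> \<le> (8 * M + 4 * (M / N) * (8 * pi * N)) * (16 * pi * N) / sqrt (\<bar>\<tau>\<bar> * ?c)"
    using sub le M_nonneg N by (intro divide_right_mono mult_mono add_left_mono mult_left_mono) auto
  also have "\<dots> = 32 * (8 * M + 32 * pi * M) / sqrt \<bar>\<tau>\<bar>"
  proof -
    have sqrt_eq: "sqrt (\<bar>\<tau>\<bar> * ?c) = sqrt \<bar>\<tau>\<bar> * (pi * N / 2)"
      unfolding real_sqrt_mult real_sqrt_abs using N by simp
    show ?thesis unfolding sqrt_eq using N \<tau> by (simp add: field_simps)
  qed
  finally show ?thesis .
qed

text \<open>The support lies in the square of half-side \<open>R\<close>, and the integrand vanishes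
  on that of half-side \<open>r\<close>. The frame between them is cut into two full-height side
  strips and the pieces below and above the inner square; four times 32 gives 128.\<close>

lemma osc_bound_fine:
  assumes N: "0 < N" "N \<le> 1 / 16" and \<tau>: "\<tau> \<noteq> 0"
  shows "norm (integral (cbox (- pi, - pi) (pi, pi)) (osc N p q \<tau>)) \<le> 128 * (8 * M + 32 * pi * M) / sqrt \<bar>\<tau>\<bar>"
proof -
  define R where "R = 4 * pi * N"
  define r where "r = pi * N"
  have rR: "0 < r" "r \<le> R" using N by (auto simp: r_def R_def)
  have "R \<le> pi" using mult_left_mono[OF N(2), of "4 * pi"] pi_gt_zero by (simp add: R_def)
  let ?I = "\<lambda>a b. integral (cbox a b) (osc N p q \<tau>)"
  have "(osc N p q \<tau> has_integral ?I (- R, - R) (R, R)) (cbox (- R, - R) (R, R))"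
    by (intro integrable_integral integrable_continuous cont_osc)
  then have "(osc N p q \<tau> has_integral ?I (- R, - R) (R, R)) (cbox (- pi, - pi) (pi, pi))"
  proof (rule has_integral_on_superset)
    show "osc N p q \<tau> z = 0" if "z \<notin> cbox (- R, - R) (R, R)" for z
      using osc_vanish_outer[OF N(1)] that unfolding R_def by blast
  qed (use \<open>R \<le> pi\<close> in auto)
  then have "?I (- pi, - pi) (pi, pi) = ?I (- R, - R) (R, R)" by (rule integral_unique)
  also have "\<dots> = ?I (- R, - R) (- r, R) + ?I (- r, - R) (R, R)"
    using rR by (intro integral_split_fst cont_osc) auto
  also have "?I (- r, - R) (R, R) = ?I (- r, - R) (r, R) + ?I (r, - R) (R, R)"
    using rR by (intro integral_split_fst cont_osc) auto
  also have "?I (- r, - R) (r, R) = ?I (- r, - R) (r, - r) + ?I (- r, - r) (r, R)"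
    using rR by (intro integral_split_snd cont_osc) auto
  also have "?I (- r, - r) (r, R) = ?I (- r, - r) (r, r) + ?I (- r, r) (r, R)"
    using rR by (intro integral_split_snd cont_osc) auto
  also have "?I (- r, - r) (r, r) = integral (cbox (- r, - r) (r, r)) (\<lambda>_. 0)"
    using osc_vanish_inner[OF N(1)] by (intro Henstock_Kurzweil_Integration.integral_cong) (auto simp: r_def)
  finally have "norm (?I (- pi, - pi) (pi, pi)) \<le> norm (?I (- R, - R) (- r, R))
      + norm (?I (- r, - R) (r, - r)) + norm (?I (- r, r) (r, R)) + norm (?I (r, - R) (R, R))"
    by (simp only: integral_0 add_0_left) (smt (verit) norm_triangle_ineq)
  also have "\<dots> \<le> 32 * (8 * M + 32 * pi * M) / sqrt \<bar>\<tau>\<bar> + 32 * (8 * M + 32 * pi * M) / sqrt \<bar>\<tau>\<bar>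
      + 32 * (8 * M + 32 * pi * M) / sqrt \<bar>\<tau>\<bar> + 32 * (8 * M + 32 * pi * M) / sqrt \<bar>\<tau>\<bar>"
    using rR by (intro add_mono osc_rectangle_bound[OF N \<tau>]) (auto simp: r_def R_def)
  finally show ?thesis by (simp add: algebra_simps)
qed

lemma osc_bound:
  "\<exists>C>0. \<forall>N p q \<tau>. 0 < N \<longrightarrow> \<tau> \<noteq> 0 \<longrightarrow>
    norm (integral (cbox (- pi, - pi) (pi, pi)) (osc N p q \<tau>)) \<le> C / sqrt \<bar>\<tau>\<bar>"
proof -
  obtain C where C: "\<And>N p q \<tau>. 1 / 16 \<le> N \<Longrightarrow> \<tau> \<noteq> 0 \<Longrightarrow>
    norm (integral (cbox (- pi, - pi) (pi, pi)) (osc N p q \<tau>)) \<le> C / sqrt \<bar>\<tau>\<bar>"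
    using osc_bound_coarse by blast
  \<comment> \<open>The 1 secures positivity of the constant; neither of the other two entries is
    known to be positive.\<close>
  define C' where "C' = max 1 (max C (128 * (8 * M + 32 * pi * M)))"
  have "norm (integral (cbox (- pi, - pi) (pi, pi)) (osc N p q \<tau>)) \<le> C' / sqrt \<bar>\<tau>\<bar>"
    if "0 < N" "\<tau> \<noteq> 0" for N p q \<tau>
  proof (cases "1 / 16 \<le> N")
    case True
    have "C / sqrt \<bar>\<tau>\<bar> \<le> C' / sqrt \<bar>\<tau>\<bar>" by (intro divide_right_mono) (auto simp: C'_def)
    then show ?thesis using C[OF True that(2), of p q] by linarith
  next
    case False
    have "128 * (8 * M + 32 * pi * M) / sqrt \<bar>\<tau>\<bar> \<le> C' / sqrt \<bar>\<tau>\<bar>"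
      by (intro divide_right_mono) (auto simp: C'_def)
    moreover have "norm (integral (cbox (- pi, - pi) (pi, pi)) (osc N p q \<tau>))
        \<le> 128 * (8 * M + 32 * pi * M) / sqrt \<bar>\<tau>\<bar>"
      using False that by (intro osc_bound_fine) auto
    ultimately show ?thesis by linarith
  qed
  moreover have "C' > 0" by (simp add: C'_def)
  ultimately show ?thesis by blast
qed

end

section \<open>From the plane to the kernel\<close>

text \<open>The estimates are made on pairs, where Lebesgue measure is a product and Fubini applies,
  while the kernel lives on \<open>real^2\<close>. This map and \<open>pair_of_vec\<close> carry
  results across.\<close>

definition vec_of_pair :: "real \<times> real \<Rightarrow> real^2" where
  "vec_of_pair z = fst z *\<^sub>R axis 1 1 + snd z *\<^sub>R axis 2 1"

definition pair_of_vec :: "real^2 \<Rightarrow> real \<times> real" where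
  "pair_of_vec \<xi> = (\<xi> $ 1, \<xi> $ 2)"

lemma vec_of_pair_nth [simp]: "vec_of_pair z $ 1 = fst z" "vec_of_pair z $ 2 = snd z"
  by (simp_all add: vec_of_pair_def axis_def)

lemma pair_of_vec_of_pair [simp]: "pair_of_vec (vec_of_pair z) = z"
  by (simp add: pair_of_vec_def)

lemma vec_of_pair_of_vec [simp]: "vec_of_pair (pair_of_vec \<xi>) = \<xi>"
  by (simp add: pair_of_vec_def vec_eq_iff forall_2)

lemma bounded_linear_vec_of_pair: "bounded_linear vec_of_pair"
  unfolding vec_of_pair_def[abs_def] by (intro bounded_linear_intros)

lemma vec_of_pair_scaleR: "vec_of_pair (c *\<^sub>R z) = c *\<^sub>R vec_of_pair z"
  by (simp add: vec_eq_iff forall_2)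

lemma continuous_on_pair_of_vec: "continuous_on S pair_of_vec"
  unfolding pair_of_vec_def[abs_def] by (intro continuous_intros)

lemma pair_of_vec_in_cbox_iff: "pair_of_vec \<xi> \<in> cbox (pair_of_vec u) (pair_of_vec v) \<longleftrightarrow> \<xi> \<in> cbox u v"
  by (auto simp: pair_of_vec_def mem_box_cart forall_2)

lemma pair_of_vec_image_cbox: "pair_of_vec ` cbox u v = cbox (pair_of_vec u) (pair_of_vec v)"
proof (intro set_eqI iffI)
  fix z assume "z \<in> cbox (pair_of_vec u) (pair_of_vec v)"
  then have "vec_of_pair z \<in> cbox u v" by (simp flip: pair_of_vec_in_cbox_iff)
  then show "z \<in> pair_of_vec ` cbox u v" using pair_of_vec_of_pair by (metis imageI)
qed (auto simp: pair_of_vec_in_cbox_iff)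

lemma vec_of_pair_image_cbox: "vec_of_pair ` cbox u v = cbox (vec_of_pair u) (vec_of_pair v)"
proof -
  have "cbox u v = pair_of_vec ` cbox (vec_of_pair u) (vec_of_pair v)"
    by (simp add: pair_of_vec_image_cbox)
  then show ?thesis by (simp add: image_image)
qed

lemma content_pair_of_vec_image: "measure lborel (pair_of_vec ` cbox u v) = measure lborel (cbox u v)"
proof (cases "cbox u v = {}")
  case False
  then have "u $ 1 \<le> v $ 1" "u $ 2 \<le> v $ 2" by (auto simp: interval_ne_empty_cart forall_2)
  then show ?thesis
    using content_cbox_cart[OF False] unfolding pair_of_vec_image_cbox
    by (simp add: pair_of_vec_def content_Pair UNIV_2)
qed simp

text \<open>The coordinate identification is continuous and maps boxes to boxes of equal content, so
  it transports integrals with factor 1.\<close>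

lemma has_integral_vec_of_pair:
  fixes f :: "real \<times> real \<Rightarrow> 'a::banach"
  assumes "(f has_integral I) (cbox a b)"
  shows "((\<lambda>\<xi>. f (pair_of_vec \<xi>)) has_integral I) (cbox (vec_of_pair a) (vec_of_pair b))"
proof -
  have "((\<lambda>\<xi>. f (pair_of_vec \<xi>)) has_integral (1 / 1) *\<^sub>R I) (vec_of_pair ` cbox a b)"
  proof (rule has_integral_twiddle[OF _ _ _ _ _ _ _ assms])
    show "continuous (at x) pair_of_vec" for x
      using continuous_on_pair_of_vec[of UNIV] by (simp add: continuous_on_eq_continuous_at)
    show "\<exists>w z. pair_of_vec ` cbox u v = cbox w z" for u v
      using pair_of_vec_image_cbox by blast
    show "\<exists>w z. vec_of_pair ` cbox u v = cbox w z" for u v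
      using vec_of_pair_image_cbox by blast
  qed (simp_all add: content_pair_of_vec_image)
  then show ?thesis by (simp add: vec_of_pair_image_cbox)
qed

section \<open>The cutoff as an admissible amplitude, and the rescaling of the kernel\<close>

lemma bounded_of_compact_support:
  fixes f :: "'a::euclidean_space \<Rightarrow> real"
  assumes "continuous_on UNIV f" "compact S" "\<And>z. z \<notin> S \<Longrightarrow> f z = 0"
  shows "\<exists>B\<ge>0. \<forall>z. \<bar>f z\<bar> \<le> B"
proof -
  have "bounded (f ` S)"
    by (intro compact_imp_bounded compact_continuous_image continuous_on_subset[OF assms(1)] assms) auto
  then obtain B where B: "B > 0" "\<And>y. y \<in> f ` S \<Longrightarrow> norm y \<le> B"
    using bounded_pos by metis
  have "\<bar>f z\<bar> \<le> B" for z
    using B assms(3) by (cases "z \<in> S") auto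
  then show ?thesis using B(1) by (intro exI[of _ B]) auto
qed

text \<open>On the inner square both terms of \<eta> equal 1 and cancel; outside the large square
  both are zero. One continuous derivative of the cutoff suffices for the partials, and compact
  support makes everything bounded.\<close>

lemma amplitude_cutoff:
  assumes "is_cutoff \<phi>"
  shows "\<exists>ax ay M. amplitude (\<lambda>z. \<eta> \<phi> (vec_of_pair z)) ax ay M"
proof -
  have "Ck 1 \<phi>" and one: "\<And>\<xi>. \<xi> \<in> square 1 \<Longrightarrow> \<phi> \<xi> = 1" and zero: "\<And>\<xi>. \<xi> \<notin> square 2 \<Longrightarrow> \<phi> \<xi> = 0"
    using assms by (auto simp: is_cutoff_def smooth_def)
  then have diff: "\<phi> differentiable_on UNIV"
    and cont: "\<And>v. continuous_on UNIV (\<lambda>x. frechet_derivative \<phi> (at x) v)" by simp_all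
  have d\<phi>: "(\<phi> has_derivative frechet_derivative \<phi> (at x)) (at x)" for x
    using diff by (simp add: differentiable_on_def frechet_derivative_works)
  define a where "a z = \<eta> \<phi> (vec_of_pair z)" for z
  \<comment> \<open>By the chain rule, the derivative of the dilate by \<open>c\<close> in direction
    \<open>v\<close>. The two dilates in \<eta> give the two terms of \<open>ax\<close> and of
    \<open>ay\<close>.\<close>
  define G where "G c v z = c * frechet_derivative \<phi> (at (c *\<^sub>R vec_of_pair z)) v" for c v z
  define ax where "ax z = G (1 / (2 * pi)) (axis 1 1) z - G (1 / pi) (axis 1 1) z" for z
  define ay where "ay z = G (1 / (2 * pi)) (axis 2 1) z - G (1 / pi) (axis 2 1) z" for z
  have dG: "((\<lambda>z. \<phi> (c *\<^sub>R vec_of_pair z)) has_derivative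
      (\<lambda>h. G c (axis 1 1) z * fst h + G c (axis 2 1) z * snd h)) (at z)" for c z
  proof -
    have lin: "linear (frechet_derivative \<phi> (at x))" for x
      using d\<phi> has_derivative_linear by blast
    have "((\<lambda>z. c *\<^sub>R vec_of_pair z) has_derivative (\<lambda>h. c *\<^sub>R vec_of_pair h)) (at z)"
      by (intro has_derivative_scaleR_right bounded_linear_imp_has_derivative bounded_linear_vec_of_pair)
    from has_derivative_compose[OF this d\<phi>] show ?thesis
      by (rule has_derivative_eq_rhs)
        (simp add: G_def vec_of_pair_def linear_add[OF lin] linear_cmul[OF lin] fun_eq_iff algebra_simps)
  qed
  have da: "(a has_derivative (\<lambda>h. ax z * fst h + ay z * snd h)) (at z)" for z
    unfolding a_def \<eta>_def ax_def ay_def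
    by (rule has_derivative_eq_rhs[OF has_derivative_diff[OF dG dG]]) (auto simp: algebra_simps)
  have cG: "continuous_on UNIV (G c v)" for c v
    unfolding G_def
    by (intro continuous_intros continuous_on_compose2[OF cont]
        bounded_linear.continuous_on[OF bounded_linear_vec_of_pair]) auto
  have cax: "continuous_on UNIV ax" and cay: "continuous_on UNIV ay"
    unfolding ax_def ay_def by (intro continuous_intros cG)+
  have ca: "continuous_on UNIV a"
    by (intro continuous_at_imp_continuous_on ballI has_derivative_continuous[OF da])
  have inner: "a z = 0" if z: "z \<in> cbox (- pi, - pi) (pi, pi)" for z
  proof -
    have "- pi \<le> fst z" "fst z \<le> pi" "- pi \<le> snd z" "snd z \<le> pi" using z by (cases z; auto)+
    then have "(1 / (2 * pi)) *\<^sub>R vec_of_pair z \<in> square 1" "(1 / pi) *\<^sub>R vec_of_pair z \<in> square 1"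
      by (auto simp: square_def mem_box_cart forall_2 field_simps)
    then show ?thesis by (simp add: a_def \<eta>_def one)
  qed
  let ?S = "cbox (- (4 * pi), - (4 * pi)) (4 * pi, 4 * pi)"
  have outer: "a z = 0" if z: "z \<notin> ?S" for z
  proof -
    have "\<not> (- (4 * pi) \<le> fst z \<and> fst z \<le> 4 * pi \<and> - (4 * pi) \<le> snd z \<and> snd z \<le> 4 * pi)"
      using z by (cases z) auto
    then have "(1 / (2 * pi)) *\<^sub>R vec_of_pair z \<notin> square 2" "(1 / pi) *\<^sub>R vec_of_pair z \<notin> square 2"
      by (auto simp: square_def mem_box_cart forall_2 field_simps)
    then show ?thesis by (simp add: a_def \<eta>_def zero)
  qed
  \<comment> \<open>The complement of the closed square is open and \<open>a\<close> is zero there,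
    so uniqueness of the derivative makes both partials vanish. This gives them the compact support
    that their bounds require.\<close>
  have d_outer: "ax z = 0 \<and> ay z = 0" if z: "z \<notin> ?S" for z
  proof -
    have "((\<lambda>_. 0) has_derivative (\<lambda>h. ax z * fst h + ay z * snd h)) (at z)"
      by (rule has_derivative_transform_within_open[OF da, of "- ?S"]) (use z outer in \<open>auto intro: closed_cbox\<close>)
    then have "(\<lambda>h. ax z * fst h + ay z * snd h) = (\<lambda>_. 0)"
      by (rule has_derivative_unique) (rule has_derivative_const)
    from fun_cong[OF this, of "(1, 0)"] fun_cong[OF this, of "(0, 1)"] show ?thesis by simp
  qed
  obtain B1 B2 B3 where nonneg: "B1 \<ge> 0" "B2 \<ge> 0" "B3 \<ge> 0"
    and le: "\<And>z. \<bar>a z\<bar> \<le> B1" "\<And>z. \<bar>ax z\<bar> \<le> B2" "\<And>z. \<bar>ay z\<bar> \<le> B3"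
    using bounded_of_compact_support[OF ca compact_cbox outer]
      bounded_of_compact_support[OF cax compact_cbox, of "(- (4 * pi), - (4 * pi))" "(4 * pi, 4 * pi)"]
      bounded_of_compact_support[OF cay compact_cbox, of "(- (4 * pi), - (4 * pi))" "(4 * pi, 4 * pi)"]
      d_outer by metis
  have B: "\<bar>a z\<bar> \<le> B1 + B2 + B3" "\<bar>ax z\<bar> \<le> B1 + B2 + B3" "\<bar>ay z\<bar> \<le> B1 + B2 + B3" for z
    using nonneg le[of z] by linarith+
  have "amplitude a ax ay (B1 + B2 + B3)"
    by unfold_locales (fact da cax cay inner outer B)+
  then show ?thesis unfolding a_def[abs_def] by blast
qed

text \<open>Substitution of \<zeta> = h \<xi>, with Jacobian \<open>1 / h\<^sup>2\<close> in the
  plane. The squared sum of sines is a quarter of \<open>\<omega>\<^sup>2\<close>, which turns the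
  factor 16 into 4.\<close>

lemma (in amplitude) K_eq_osc:
  assumes a: "a = (\<lambda>z. \<eta> \<phi> (vec_of_pair z))" and h: "h > 0"
  shows "K \<phi> N h x t = (1 / h\<^sup>2) *\<^sub>R integral (cbox (- pi, - pi) (pi, pi)) (osc N (x $ 1 / h) (x $ 2 / h) (4 * t / h ^ 4))"
proof -
  let ?P = "cbox (- pi, - pi) (pi, pi)"
  let ?g = "osc N (x $ 1 / h) (x $ 2 / h) (4 * t / h ^ 4)"
  let ?f = "\<lambda>\<xi>. ?g (pair_of_vec (h *\<^sub>R \<xi>))"
  \<comment> \<open>The vacuous translation gives the torus the shape in which
    \<open>has_integral_affinity\<close> with dilation \<open>h\<close> and shift 0 states its
    domain.\<close>
  have torus: "torus h = (\<lambda>\<xi>. (1 / h) *\<^sub>R \<xi> + - ((1 / h) *\<^sub>R 0)) ` square pi"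
    by (simp add: torus_def)
  have sq: "square pi = cbox (vec_of_pair (- pi, - pi)) (vec_of_pair (pi, pi))"
    unfolding square_def by (intro arg_cong2[of _ _ _ _ cbox]) (auto simp: vec_eq_iff forall_2)
  have "(?g has_integral integral ?P ?g) ?P"
    by (intro integrable_integral integrable_continuous cont_osc)
  from has_integral_affinity[OF has_integral_vec_of_pair[OF this], of h 0]
  have "(?f has_integral (1 / h\<^sup>2) *\<^sub>R integral ?P ?g) (torus h)"
    using h by (simp add: torus sq)
  then have HK: "integral (torus h) ?f = (1 / h\<^sup>2) *\<^sub>R integral ?P ?g" by (rule integral_unique)
  have "compact (torus h)"
    unfolding torus_def square_def by (intro compact_continuous_image continuous_intros) auto
  moreover have "continuous_on (torus h) ?f"
    by (intro continuous_on_compose2[OF cont_osc] continuous_on_compose2[OF continuous_on_pair_of_vec]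
        continuous_intros) auto
  ultimately have "set_integrable lborel (torus h) ?f"
    unfolding set_integrable_def by (rule borel_integrable_compact)
  then have "(LINT \<xi>:torus h|lborel. ?f \<xi>) = integral (torus h) ?f"
    by (rule set_borel_integral_eq_integral)
  moreover have "exp (\<i> * of_real (x \<bullet> \<xi>)
           + \<i> * of_real (16 * t / h ^ 4 * (\<Sum>j\<in>UNIV. (sin (h * \<xi> $ j / 2))\<^sup>2)\<^sup>2))
        * of_real (\<eta> \<phi> ((h / N) *\<^sub>R \<xi>)) = ?f \<xi>" for \<xi>
  proof -
    have c: "cos y = 1 - 2 * (sin (y / 2))\<^sup>2" for y :: real
      using cos_double_sin[of "y / 2"] by simp
    have "\<omega> (pair_of_vec (h *\<^sub>R \<xi>)) = 2 * (\<Sum>j\<in>UNIV. (sin (h * \<xi> $ j / 2))\<^sup>2)"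
      by (simp add: \<omega>_def pair_of_vec_def UNIV_2 c[of "h * _"])
    then have phase: "16 * t / h ^ 4 * (\<Sum>j\<in>UNIV. (sin (h * \<xi> $ j / 2))\<^sup>2)\<^sup>2
        = 4 * t / h ^ 4 * (\<omega> (pair_of_vec (h *\<^sub>R \<xi>)))\<^sup>2"
      by (simp add: power_mult_distrib)
    have lin: "x \<bullet> \<xi> = x $ 1 / h * fst (pair_of_vec (h *\<^sub>R \<xi>)) + x $ 2 / h * snd (pair_of_vec (h *\<^sub>R \<xi>))"
      using h by (simp add: inner_vec_def UNIV_2 pair_of_vec_def)
    have amp: "\<eta> \<phi> ((h / N) *\<^sub>R \<xi>) = a ((1 / N) *\<^sub>R pair_of_vec (h *\<^sub>R \<xi>))"
      by (simp add: a vec_of_pair_scaleR)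
    show ?thesis
      unfolding phase lin amp osc_def cis_conv_exp
      by (simp add: scaleR_conv_of_real distrib_left)
  qed
  ultimately show ?thesis by (simp add: K_def HK)
qed

theorem theorem1p1:
  fixes \<phi> :: "real^2 \<Rightarrow> real"
  assumes "is_cutoff \<phi>"
  shows "\<exists>C T :: real. C > 0 \<and> T > 0 \<and>
    (\<forall>t N h :: real. \<forall>x :: real^2.
       \<bar>t\<bar> \<ge> T \<longrightarrow> N \<in> dyadic \<longrightarrow> N \<le> 1 \<longrightarrow> h > 0 \<longrightarrow> x \<in> lattice h \<longrightarrow>
         norm (K \<phi> N h x t) \<le> C * \<bar>t\<bar> powr (- 1 / 2))"
proof -
  obtain ax ay M where "amplitude (\<lambda>z. \<eta> \<phi> (vec_of_pair z)) ax ay M"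
    using amplitude_cutoff[OF assms] by blast
  then interpret amplitude "\<lambda>z. \<eta> \<phi> (vec_of_pair z)" ax ay M .
  obtain C where C: "C > 0" and bound: "\<And>N p q \<tau>. 0 < N \<Longrightarrow> \<tau> \<noteq> 0 \<Longrightarrow>
    norm (integral (cbox (- pi, - pi) (pi, pi)) (osc N p q \<tau>)) \<le> C / sqrt \<bar>\<tau>\<bar>"
    using osc_bound by blast
  have "norm (K \<phi> N h x t) \<le> C * \<bar>t\<bar> powr (- 1 / 2)"
    if t: "1 \<le> \<bar>t\<bar>" and N: "N \<in> dyadic" and h: "h > 0" for t N h x
  proof -
    have "N > 0" using N by (auto simp: dyadic_def)
    have "norm (K \<phi> N h x t)
        = 1 / h\<^sup>2 * norm (integral (cbox (- pi, - pi) (pi, pi)) (osc N (x $ 1 / h) (x $ 2 / h) (4 * t / h ^ 4)))"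
      by (simp add: K_eq_osc[OF refl h])
    also have "\<dots> \<le> 1 / h\<^sup>2 * (C / sqrt \<bar>4 * t / h ^ 4\<bar>)"
      using t h \<open>N > 0\<close> by (intro mult_left_mono bound) auto
    \<comment> \<open>The factor \<open>h\<^sup>2\<close> gained from the decay in \<tau> cancels
      the Jacobian exactly, hence uniformity in \<open>h\<close>.\<close>
    also have "sqrt \<bar>4 * t / h ^ 4\<bar> = 2 * sqrt \<bar>t\<bar> / h\<^sup>2"
    proof -
      have "sqrt (h ^ 4) = h\<^sup>2"
        by (rule real_sqrt_unique) (auto simp: power_mult[symmetric])
      then show ?thesis by (simp add: real_sqrt_divide real_sqrt_mult abs_mult)
    qed
    also have "1 / h\<^sup>2 * (C / (2 * sqrt \<bar>t\<bar> / h\<^sup>2)) = C / 2 * (1 / sqrt \<bar>t\<bar>)"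
      using h by simp
    also have "\<dots> \<le> C * (1 / sqrt \<bar>t\<bar>)"
      using C by (intro mult_right_mono) auto
    also have "1 / sqrt \<bar>t\<bar> = \<bar>t\<bar> powr (- 1 / 2)"
      using t by (simp add: powr_minus_divide powr_half_sqrt)
    finally show ?thesis .
  qed
  \<comment> \<open>The threshold 1 for \<open>T\<close> keeps \<open>t\<close>, and with it \<tau>,
    away from zero.\<close>
  then show ?thesis using C by (intro exI[of _ C] exI[of _ 1]) auto
qed

end
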